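(* For all nonzero integers $r,s,t$, the rational number $\frac{r+t}{rst}$ is a limit of a non-constant sequence of non-free rational numbers.
   Context: For $q\in\mathbb{R}$ let $A=\begin{pmatrix}1&1\\0&1\end{pmatrix}$, $B_q=\begin{pmatrix}1&0\\ q&1\end{pmatrix}$, and let $G_q=\langle A,B_q\rangle\leqslant \operatorname{SL}(2,\mathbb{R})$. A rational number $q$ is called non-free if $G_q$ is not freely generated by $A$ and $B_q$, i.e. if there is a non-trivial element $w$ of the free group $F_2=\langle a,b\rangle$ with $w(A,B_q)=I_2$, where $w(A,B_q)$ denotes the image of $w$ under the homomorphism $a\mapsto A$, $b\mapsto B_q$. *)

theory Defs
  imports "HOL-Analysis.Analysis" "HOL-Algebra.Group"
begin

text \<open>
  The free group on all elements of a type, modelled by reduced words: the letter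
  \<open>(x, True)\<close> stands for the generator \<open>x\<close>, and \<open>(x, False)\<close> for its inverse.
  Multiplication is concatenation followed by free reduction.
\<close>

type_synonym 'x letter = "'x \<times> bool"

definition inv_letter :: "'x letter \<Rightarrow> 'x letter" where
  "inv_letter l = (fst l, \<not> snd l)"

fun reduced :: "'x letter list \<Rightarrow> bool" where
  "reduced [] = True"
| "reduced [l] = True"
| "reduced (l # m # w) = (m \<noteq> inv_letter l \<and> reduced (m # w))"

fun cons_reduce :: "'x letter \<Rightarrow> 'x letter list \<Rightarrow> 'x letter list" where
  "cons_reduce l [] = [l]"
| "cons_reduce l (m # w) = (if m = inv_letter l then w else l # m # w)"

definition reduce :: "'x letter list \<Rightarrow> 'x letter list" where
  "reduce w = foldr cons_reduce w []"

definition free_group :: "'x letter list monoid" where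
  "free_group = \<lparr>carrier = {w. reduced w}, mult = (\<lambda>u v. reduce (u @ v)), one = []\<rparr>"

text \<open>The value of a word in a group \<open>G\<close> when each generator \<open>x\<close> is replaced by \<open>f x\<close>.\<close>

definition word_value ::
    "('g, 'm) monoid_scheme \<Rightarrow> ('x \<Rightarrow> 'g) \<Rightarrow> 'x letter list \<Rightarrow> 'g" where
  "word_value G f w =
     foldr (\<lambda>(x, e) y. (if e then f x else inv\<^bsub>G\<^esub> (f x)) \<otimes>\<^bsub>G\<^esub> y) w \<one>\<^bsub>G\<^esub>"

definition SL2 :: "(real^2^2) monoid" where
  "SL2 = \<lparr>carrier = {M. det M = 1}, mult = (**), one = mat 1\<rparr>"

definition mat_A :: "real^2^2" where
  "mat_A = vector [vector [1, 1], vector [0, 1]]"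

definition mat_B :: "real \<Rightarrow> real^2^2" where
  "mat_B q = vector [vector [1, 0], vector [q, 1]]"

datatype gen = Gen_a | Gen_b

definition gen_image :: "real \<Rightarrow> gen \<Rightarrow> real^2^2" where
  "gen_image q g = (case g of Gen_a \<Rightarrow> mat_A | Gen_b \<Rightarrow> mat_B q)"

definition non_free :: "rat \<Rightarrow> bool" where
  "non_free q \<longleftrightarrow>
     (\<exists>w \<in> carrier (free_group :: gen letter list monoid).
        w \<noteq> \<one>\<^bsub>free_group\<^esub> \<and>
        word_value SL2 (gen_image (real_of_rat q)) w = \<one>\<^bsub>SL2\<^esub>)"

text \<open>Consistency of the above: these are groups, and evaluation of words is the
  homomorphism determined by the images of the generators.\<close>

lemma inv_letter_inv_letter [simp]: "inv_letter (inv_letter l) = l"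
  by (simp add: inv_letter_def)

lemma inv_letter_neq [simp]: "inv_letter l \<noteq> l" "l \<noteq> inv_letter l"
  by (auto simp: inv_letter_def prod_eq_iff)

lemma reduced_ConsD: "reduced (l # w) \<Longrightarrow> reduced w"
  by (cases w) auto

lemma reduced_cons_reduce: "reduced w \<Longrightarrow> reduced (cons_reduce l w)"
  by (cases w) (auto dest: reduced_ConsD)

lemma cons_reduce_cancel:
  "reduced w \<Longrightarrow> cons_reduce l (cons_reduce (inv_letter l) w) = w"
proof (cases w)
  case (Cons m v)
  then show "reduced w \<Longrightarrow> ?thesis" by (cases v) auto
qed simp

lemma reduced_foldr: "reduced v \<Longrightarrow> reduced (foldr cons_reduce u v)"
  by (induction u) (auto simp: reduced_cons_reduce)

lemma reduced_reduce: "reduced (reduce w)"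
  by (simp add: reduce_def reduced_foldr)

lemma reduce_id: "reduced w \<Longrightarrow> reduce w = w"
proof (induction w)
  case (Cons l w)
  then have "reduce w = w" by (blast dest: reduced_ConsD)
  with Cons.prems show ?case by (cases w) (auto simp: reduce_def)
qed (simp add: reduce_def)

lemma foldr_cons_reduce:
  assumes "reduced v"
  shows "foldr cons_reduce (cons_reduce l u) v = cons_reduce l (foldr cons_reduce u v)"
proof (cases u)
  case (Cons m w)
  have "cons_reduce l (cons_reduce (inv_letter l) (foldr cons_reduce w v)) = foldr cons_reduce w v"
    by (intro cons_reduce_cancel reduced_foldr assms)
  with Cons show ?thesis by auto
qed simp

lemma foldr_reduce:
  "reduced v \<Longrightarrow> foldr cons_reduce (reduce u) v = foldr cons_reduce u v"
  by (induction u) (auto simp: reduce_def foldr_cons_reduce)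

lemma reduce_append: "reduce (u @ v) = foldr cons_reduce u (reduce v)"
  by (simp add: reduce_def)

lemma reduce_left: "reduce (reduce u @ v) = reduce (u @ v)"
  by (simp add: reduce_append foldr_reduce reduced_reduce)

lemma reduce_right: "reduce (u @ reduce v) = reduce (u @ v)"
  by (simp add: reduce_append reduce_id reduced_reduce)

lemma reduce_inverse: "reduce (rev (map inv_letter w) @ w) = []"
proof (induction w)
  case (Cons l w)
  have "cons_reduce (inv_letter l) (cons_reduce l (reduce w)) = reduce w"
    using cons_reduce_cancel[of "reduce w" "inv_letter l"] by (simp add: reduced_reduce)
  then show ?case using Cons by (simp add: reduce_append) (simp add: reduce_def)
qed (simp add: reduce_def)

lemma group_free_group: "group (free_group :: 'x letter list monoid)"
proof (rule groupI, goal_cases)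
  case (3 x y z)
  show ?case by (simp add: free_group_def reduce_left reduce_right)
next
  case (5 x)
  have "reduce (reduce (rev (map inv_letter x)) @ x) = []"
    by (simp add: reduce_left reduce_inverse)
  then show ?case
    by (auto simp: free_group_def intro!: bexI[of _ "reduce (rev (map inv_letter x))"] reduced_reduce)
qed (auto simp: free_group_def reduced_reduce reduce_id)

lemma group_SL2: "group SL2"
proof (rule groupI, goal_cases)
  case (5 M)
  then have *: "det M = 1" by (simp add: SL2_def)
  then have "invertible M" by (simp add: invertible_det_nz)
  then obtain N where N: "N ** M = mat 1" by (auto simp: invertible_def)
  then have "det N * det M = 1" by (metis det_I det_mul)
  with * N show ?case by (auto simp: SL2_def)
qed (auto simp: SL2_def det_mul matrix_mul_assoc)

lemma gen_image_SL2: "gen_image q g \<in> carrier SL2"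
  by (cases g) (auto simp: gen_image_def mat_A_def mat_B_def SL2_def det_2)

context group
begin

context
  fixes f :: "'x \<Rightarrow> 'a"
  assumes f: "\<And>x. f x \<in> carrier G"
begin

lemma word_value_closed: "word_value G f w \<in> carrier G"
  by (induction w) (auto simp: word_value_def f)

lemma word_value_Cons:
  "word_value G f (l # w) =
     (if snd l then f (fst l) else inv (f (fst l))) \<otimes> word_value G f w"
  by (cases l) (simp add: word_value_def)

lemma word_value_cons_reduce: "word_value G f (cons_reduce l w) = word_value G f (l # w)"
proof (cases w)
  case (Cons m v)
  then show ?thesis
    using f[of "fst l"] word_value_closed[of v]
    by (auto simp: word_value_Cons inv_letter_def m_assoc[symmetric])
qed simp

lemma word_value_append: "word_value G f (u @ v) = word_value G f u \<otimes> word_value G f v"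
proof (induction u)
  case Nil
  then show ?case using word_value_closed[of v] by (simp add: word_value_def)
next
  case (Cons l u)
  then show ?case by (simp add: word_value_Cons m_assoc word_value_closed f)
qed

lemma word_value_reduce: "word_value G f (reduce w) = word_value G f w"
proof (induction w)
  case (Cons l w)
  have "word_value G f (reduce (l # w)) = word_value G f (l # reduce w)"
    using word_value_cons_reduce[of l "reduce w"] by (simp add: reduce_def)
  with Cons show ?case by (simp add: word_value_Cons)
qed (simp add: reduce_def)

lemma word_value_hom: "word_value G f \<in> hom free_group G"
  by (auto simp: hom_def free_group_def word_value_closed word_value_reduce word_value_append)

lemma word_value_generator: "word_value G f [(x, True)] = f x"
  by (simp add: word_value_def f)

end

end

end

theory Submission
  imports Defs
begin

text \<open>
  A reduced word \<open>w\<close> that begins and ends with a letter \<open>a\<^sup>\<plusminus>\<^sup>1\<close> and whose value \<open>W\<close> in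
  \<open>G\<^sub>q\<close> is lower triangular witnesses that \<open>q\<close> is non-free: \<open>W B W\<^sup>-\<^sup>1\<close> and \<open>B\<close> are then both
  lower unitriangular, so they commute, while \<open>w b w\<^sup>-\<^sup>1\<close> and \<open>b\<close> do not commute in the free
  group (\<open>non_free_if_lower_triangular\<close>).

  The numbers \<open>(r + t) / (r s t)\<close> are exactly those for which \<open>A\<^sup>r B\<^sup>-\<^sup>s A\<^sup>t\<close> is lower
  triangular. To perturb them, append two more factors and look at the upper right entry of
  \<open>A\<^sup>r B\<^sup>-\<^sup>s A\<^sup>t B\<^sup>-\<^sup>n A\<^sup>y\<close>, which is a quadratic polynomial in \<open>q\<close> with constant term
  \<open>r + t + y\<close>. In general its roots are irrational, but for \<open>y = -(r + t)\<close> one root is \<open>0\<close>, so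
  the other one is rational; it is \<open>(r + t) / (r s t) + r / (t (r + t) n)\<close>
  (\<open>non_free_perturbation\<close>). Letting \<open>n\<close> tend to infinity gives the theorem if \<open>r + t\<close> is not
  zero. If it is zero, the limit to be reached is \<open>0\<close>, and the perturbations for
  \<open>r = t = 1\<close> and \<open>s = n\<close>, that is the numbers \<open>5 / (2 n)\<close>, tend to it.
\<close>

section \<open>Reduced words\<close>

lemma reduced_Cons: "reduced (l # v) \<longleftrightarrow> reduced v \<and> (v \<noteq> [] \<longrightarrow> hd v \<noteq> inv_letter l)"
  by (cases v) auto

lemma reduced_append:
  "reduced (u @ v) \<longleftrightarrow>
     reduced u \<and> reduced v \<and> (u \<noteq> [] \<longrightarrow> v \<noteq> [] \<longrightarrow> hd v \<noteq> inv_letter (last u))"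
  by (induction u) (auto simp: reduced_Cons hd_append)

definition inv_word :: "'x letter list \<Rightarrow> 'x letter list" where
  "inv_word w = rev (map inv_letter w)"

lemma reduced_inv_word: "reduced w \<Longrightarrow> reduced (inv_word w)"
proof (induction w)
  case (Cons l w)
  then show ?case
    by (cases w) (auto simp: inv_word_def reduced_append)
qed (simp add: inv_word_def)

definition gen_power :: "'x \<Rightarrow> int \<Rightarrow> 'x letter list" where
  "gen_power x k = replicate (nat \<bar>k\<bar>) (x, k > 0)"

lemma reduced_gen_power: "reduced (gen_power x k)"
proof -
  have "reduced (replicate m l)" for m and l :: "'x letter"
  proof (induction m)
    case (Suc m)
    then show ?case by (cases m) auto
  qed simp
  then show ?thesis by (simp add: gen_power_def)
qed

lemma gen_power_nonempty: "k \<noteq> 0 \<Longrightarrow> gen_power x k \<noteq> []"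
  by (simp add: gen_power_def)

lemma hd_gen_power: "k \<noteq> 0 \<Longrightarrow> hd (gen_power x k) = (x, k > 0)"
  by (simp add: gen_power_def hd_replicate)

lemma last_gen_power: "k \<noteq> 0 \<Longrightarrow> last (gen_power x k) = (x, k > 0)"
  by (simp add: gen_power_def last_replicate)

section \<open>Values of words as 2 by 2 matrices\<close>

definition mat2 :: "real \<Rightarrow> real \<Rightarrow> real \<Rightarrow> real \<Rightarrow> real^2^2" where
  "mat2 a b c d = vector [vector [a, b], vector [c, d]]"

lemma mat2_mult:
  "mat2 a b c d ** mat2 a' b' c' d' =
     mat2 (a * a' + b * c') (a * b' + b * d') (c * a' + d * c') (c * b' + d * d')"
  by (simp add: mat2_def matrix_matrix_mult_def vec_eq_iff forall_2 sum_2)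

lemma mat_1_eq_mat2: "mat 1 = mat2 1 0 0 1"
  by (simp add: mat2_def mat_def vec_eq_iff forall_2)

lemma det_mat2: "det (mat2 a b c d) = a * d - b * c"
  by (simp add: mat2_def det_2)

lemma mat2_entries: "M = mat2 (M$1$1) (M$1$2) (M$2$1) (M$2$2)"
  by (simp add: mat2_def vec_eq_iff forall_2)

lemma inv_SL2_mat2:
  assumes "a * d - b * c = 1"
  shows "inv\<^bsub>SL2\<^esub> (mat2 a b c d) = mat2 d (- b) (- c) a"
proof (rule group.inv_equality[OF group_SL2])
  show "mat2 d (- b) (- c) a \<otimes>\<^bsub>SL2\<^esub> mat2 a b c d = \<one>\<^bsub>SL2\<^esub>"
    using assms by (simp add: SL2_def mat2_mult mat_1_eq_mat2 algebra_simps)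
qed (use assms in \<open>auto simp: SL2_def det_mat2 algebra_simps\<close>)

definition value_at :: "real \<Rightarrow> gen letter list \<Rightarrow> real^2^2" where
  "value_at q = word_value SL2 (gen_image q)"

lemma value_at_Nil: "value_at q [] = mat2 1 0 0 1"
  by (simp add: value_at_def word_value_def SL2_def mat_1_eq_mat2)

lemma value_at_append: "value_at q (u @ v) = value_at q u ** value_at q v"
  using group.word_value_append[OF group_SL2 gen_image_SL2]
  by (simp add: value_at_def SL2_def)

lemma value_at_a: "value_at q [(Gen_a, e)] = mat2 1 (if e then 1 else -1) 0 1"
  using inv_SL2_mat2[of 1 1 1 0]
  by (simp add: value_at_def word_value_def gen_image_def mat_A_def mat2_def[symmetric])
     (simp add: SL2_def)

lemma value_at_b: "value_at q [(Gen_b, e)] = mat2 1 0 (if e then q else - q) 1"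
  using inv_SL2_mat2[of 1 1 0 q]
  by (simp add: value_at_def word_value_def gen_image_def mat_B_def mat2_def[symmetric])
     (simp add: SL2_def)

lemma value_at_a_power: "value_at q (gen_power Gen_a k) = mat2 1 (of_int k) 0 1"
proof -
  have "value_at q (replicate m (Gen_a, e)) = mat2 1 (if e then real m else - real m) 0 1" for m e
  proof (induction m)
    case (Suc m)
    then show ?case
      using value_at_append[of q "[(Gen_a, e)]"] by (simp add: value_at_a mat2_mult algebra_simps)
  qed (simp add: value_at_Nil)
  then show ?thesis by (simp add: gen_power_def)
qed

lemma value_at_b_power: "value_at q (gen_power Gen_b k) = mat2 1 0 (of_int k * q) 1"
proof -
  have "value_at q (replicate m (Gen_b, e)) =
          mat2 1 0 (if e then real m * q else - real m * q) 1" for m e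
  proof (induction m)
    case (Suc m)
    then show ?case
      using value_at_append[of q "[(Gen_b, e)]"]
      by (simp add: value_at_b mat2_mult algebra_simps)
  qed (simp add: value_at_Nil)
  then show ?thesis by (simp add: gen_power_def)
qed

lemma value_at_in_SL2: "value_at q w \<in> carrier SL2"
  unfolding value_at_def by (rule group.word_value_closed[OF group_SL2 gen_image_SL2])

lemma value_at_inv_word: "value_at q (inv_word w) = inv\<^bsub>SL2\<^esub> (value_at q w)"
proof (rule group.inv_equality[OF group_SL2, symmetric])
  have "value_at q (inv_word w @ w) = value_at q []"
    using group.word_value_reduce[OF group_SL2 gen_image_SL2, where w = "inv_word w @ w"]
    by (simp add: value_at_def inv_word_def reduce_inverse)
  then show "value_at q (inv_word w) \<otimes>\<^bsub>SL2\<^esub> value_at q w = \<one>\<^bsub>SL2\<^esub>"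
    by (simp add: value_at_append value_at_Nil SL2_def mat_1_eq_mat2)
qed (rule value_at_in_SL2)+

section \<open>Non-free numbers\<close>

lemma non_freeI:
  assumes "reduced w" and "w \<noteq> []" and "value_at (of_rat q) w = mat2 1 0 0 1"
  shows "non_free q"
  using assms unfolding non_free_def value_at_def
  by (intro bexI[of _ w]) (auto simp: free_group_def SL2_def mat_1_eq_mat2)

text \<open>
  The relation is the commutator of \<open>w b w\<^sup>-\<^sup>1\<close> and \<open>b\<close>. The conditions on the first and the
  last letter of \<open>w\<close> keep the written-out commutator free of cancellations.
\<close>

lemma non_free_if_lower_triangular:
  assumes red: "reduced w" and "w \<noteq> []"
    and hd: "fst (hd w) = Gen_a" and last: "fst (last w) = Gen_a"
    and upper: "value_at (of_rat q) w $ 1 $ 2 = 0"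
  shows "non_free q"
proof (rule non_freeI)
  let ?b = "[(Gen_b, True)]" and ?b' = "[(Gen_b, False)]" and ?w' = "inv_word w"
  let ?rel = "w @ ?b @ ?w' @ ?b @ w @ ?b' @ ?w' @ ?b'"
  have w': "reduced ?w'" "?w' \<noteq> []"
    using red \<open>w \<noteq> []\<close> by (auto simp: reduced_inv_word) (simp add: inv_word_def)
  have ends: "fst (hd ?w') = Gen_a" "fst (last ?w') = Gen_a"
    using \<open>w \<noteq> []\<close> hd last
    by (simp_all add: inv_word_def hd_rev last_rev last_map hd_map inv_letter_def)
  show "reduced ?rel"
    using red w' \<open>w \<noteq> []\<close> hd last ends
    by (auto simp: reduced_append reduced_Cons hd_append inv_letter_def prod_eq_iff)
  show "?rel \<noteq> []" by simp
  define q' :: real where "q' = of_rat q"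
  obtain a c d where W: "value_at q' w = mat2 a 0 c d"
    using upper mat2_entries[of "value_at q' w"] unfolding q'_def by metis
  have ad: "a * d = 1"
    using value_at_in_SL2[of q' w] by (simp add: W SL2_def det_mat2)
  have W': "value_at q' ?w' = mat2 d 0 (- c) a"
    using inv_SL2_mat2[of a d 0 c] ad by (simp add: value_at_inv_word W)
  have da: "d * a = 1" using ad by (simp add: mult.commute)
  have conj: "value_at q' (w @ [(Gen_b, e)] @ ?w') =
      mat2 1 0 (d * d * (if e then q' else - q')) 1" for e
    unfolding value_at_append W W' value_at_b mat2_mult
    using ad da by (simp add: algebra_simps)
  have "value_at q' ?rel =
      value_at q' (w @ ?b @ ?w') ** (value_at q' ?b **
        (value_at q' (w @ ?b' @ ?w') ** value_at q' ?b'))"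
    by (simp only: value_at_append matrix_mul_assoc)
  also have "\<dots> = mat2 1 0 0 1"
    unfolding conj value_at_b mat2_mult by simp
  finally show "value_at (of_rat q) ?rel = mat2 1 0 0 1" unfolding q'_def .
qed

text \<open>
  The relation comes from \<open>A\<^sup>r B\<^sup>-\<^sup>s A\<^sup>t B\<^sup>-\<^sup>n A\<^sup>-\<^sup>(\<^sup>r\<^sup>+\<^sup>t\<^sup>)\<close>. As the exponents of \<open>A\<close> add up to
  zero, its upper right entry is \<open>q\<close> times a linear polynomial in \<open>q\<close>, and the number below
  is the root of the latter.
\<close>

lemma non_free_perturbation:
  fixes r s t n :: int
  assumes nz: "r \<noteq> 0" "s \<noteq> 0" "t \<noteq> 0" "n \<noteq> 0" "r + t \<noteq> 0"
  shows "non_free (of_int (r + t) / of_int (r * s * t) + of_int r / of_int (t * (r + t) * n))"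
    (is "non_free ?q")
proof (rule non_free_if_lower_triangular)
  let ?u = "gen_power Gen_b (- s) @ gen_power Gen_a t @ gen_power Gen_b (- n)"
  let ?w = "gen_power Gen_a r @ ?u @ gen_power Gen_a (- (r + t))"
  have nz': "- s \<noteq> 0" "- n \<noteq> 0" "- (r + t) \<noteq> 0" using nz by auto
  note gp = nz(1,3) nz' gen_power_nonempty hd_gen_power last_gen_power
  show "reduced ?w" "?w \<noteq> []" "fst (hd ?w) = Gen_a" "fst (last ?w) = Gen_a"
    using nz'
    by (simp_all only: reduced_append reduced_gen_power gp hd_append last_append inv_letter_def
          append_is_Nil_conv if_False prod.inject gen.distinct fst_conv simp_thms)
  define R S T N where "R = real_of_int r" and "S = real_of_int s" and "T = real_of_int t"
    and "N = real_of_int n"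
  have nzR: "R \<noteq> 0" "S \<noteq> 0" "T \<noteq> 0" "N \<noteq> 0" "R + T \<noteq> 0"
    using nz unfolding R_def S_def T_def N_def by (simp_all flip: of_int_add)
  define q :: real where "q = of_rat ?q"
  have q: "q = (R + T) / (R * S * T) + R / (T * (R + T) * N)"
    by (simp add: q_def of_rat_add of_rat_mult of_rat_divide R_def S_def T_def N_def)
  have root: "q * (R * S * T * (R + T) * N) = (R + T)\<^sup>2 * N + R\<^sup>2 * S"
    unfolding q using nzR by (simp add: divide_simps) algebra
  have "value_at q ?w $ 1 $ 2 =
      q * ((R + T)\<^sup>2 * N + R\<^sup>2 * S - q * (R * S * T * (R + T) * N))"
    unfolding value_at_append value_at_a_power value_at_b_power mat2_mult
    by (simp add: mat2_def R_def S_def T_def N_def algebra_simps power2_eq_square)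
  then show "value_at (of_rat ?q) ?w $ 1 $ 2 = 0"
    by (simp only: root diff_self mult_zero_right q_def[symmetric])
qed

section \<open>Limits of non-free numbers\<close>

lemma limit_of_non_free:
  fixes c d :: rat
  assumes nf: "\<And>n :: nat. non_free (c + d / of_nat (Suc n))" and "d \<noteq> 0"
  shows "\<exists>x :: nat \<Rightarrow> rat.
           (\<forall>n. non_free (x n)) \<and>
           \<not> (\<exists>c. \<forall>\<^sub>F n in sequentially. x n = c) \<and>
           (\<lambda>n. real_of_rat (x n)) \<longlonglongrightarrow> of_rat c"
proof (intro exI[of _ "\<lambda>n. c + d / of_nat (Suc n)"] conjI allI nf notI)
  assume "\<exists>e. \<forall>\<^sub>F n in sequentially. c + d / of_nat (Suc n) = e"
  then obtain e N where e: "\<And>n. n \<ge> N \<Longrightarrow> c + d / of_nat (Suc n) = e"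
    by (auto simp: eventually_sequentially)
  have "d / of_nat (Suc N) = d / of_nat (Suc (Suc N))"
    using e[of N] e[of "Suc N"] by (metis add_left_imp_eq le_refl le_SucI)
  then show False
    using \<open>d \<noteq> 0\<close> by (simp add: divide_simps del: of_nat_Suc)
next
  have "(\<lambda>n. real_of_rat c + real_of_rat d * inverse (real (Suc n)))
          \<longlonglongrightarrow> real_of_rat c + real_of_rat d * 0"
    by (intro tendsto_intros LIMSEQ_inverse_real_of_nat)
  then show "(\<lambda>n. real_of_rat (c + d / of_nat (Suc n))) \<longlonglongrightarrow> of_rat c"
    by (simp add: of_rat_add of_rat_mult of_rat_inverse divide_inverse del: of_nat_Suc)
qed

theorem theorem1p2:
  fixes r s t :: int
  assumes "r \<noteq> 0" and "s \<noteq> 0" and "t \<noteq> 0"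
  shows "\<exists>x :: nat \<Rightarrow> rat.
           (\<forall>n. non_free (x n)) \<and>
           \<not> (\<exists>c. \<forall>\<^sub>F n in sequentially. x n = c) \<and>
           (\<lambda>n. real_of_rat (x n)) \<longlonglongrightarrow> real_of_int (r + t) / real_of_int (r * s * t)"
proof (cases "r + t = 0")
  case False
  have "non_free (of_int (r + t) / of_int (r * s * t) +
          of_int r / of_int (t * (r + t)) / of_nat (Suc n))" for n
    using non_free_perturbation[of r s t "int (Suc n)"] assms False by simp
  from limit_of_non_free[OF this] show ?thesis
    using assms False by (simp add: of_rat_divide flip: of_int_add of_int_mult)
next
  case True
  have "non_free (0 + (5 / 2) / of_nat (Suc n))" for n
  proof -
    have "2 / of_nat (Suc n) + 1 / (2 * of_nat (Suc n)) = (0 + (5 / 2) / of_nat (Suc n) :: rat)"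
      by (simp add: divide_simps del: of_nat_Suc)
    then show ?thesis
      using non_free_perturbation[of 1 "int (Suc n)" 1 "int (Suc n)"] by simp
  qed
  from limit_of_non_free[OF this] show ?thesis
    using True by simp
qed

end
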